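(* Let $M\subset\mathbb{C}$ be a set for which there exists a sequence $K_i$, $i\ge 1$, of compact subsets of $M$ such that for every compact set $K\subseteq M$ with $\mathbb{C}\setminus K$ connected there exists $i_0$ with $K\subseteq K_{i_0}$. Then $M\cap\partial M$ is open in the relative topology of $\partial M$.
   Context: $\partial M$ denotes the topological boundary of $M$ in $\mathbb{C}$. *)

theory Defs
  imports "HOL-Analysis.Analysis"
begin

end

theory Submission
  imports Defs
begin

text \<open>If points of \<^term>\<open>frontier M - M\<close> accumulate at \<open>z \<in> M\<close>, then near \<open>z\<close> no compact subset of
  \<open>M\<close> exhausts \<open>M\<close>. So one can pick \<open>x n \<in> M - K n\<close> with \<open>x n\<close> converging to \<open>z\<close>. The set consisting
  of \<open>z\<close> and all \<open>x n\<close> is compact and countable, so its complement is connected, yet it lies in no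
  \<open>K n\<close>.\<close>

text \<open>Since \<open>K\<close> is closed and misses \<open>w\<close>, \<open>U - K\<close> is
  still an open neighbourhood of \<open>w\<close>; as \<open>w\<close> lies in the closure of
  \<open>M\<close>, this neighbourhood meets \<open>M\<close>.\<close>

lemma frontier_not_mem_escapes_compact:
  fixes M K :: "'a::metric_space set"
  assumes "compact K" "K \<subseteq> M" "w \<in> frontier M" "w \<notin> M" "open U" "w \<in> U"
  obtains x where "x \<in> M" "x \<notin> K" "x \<in> U"
proof -
  have "w \<in> U - K" "open (U - K)"
    using assms by (auto intro: open_Diff compact_imp_closed)
  moreover have "w \<in> closure M"
    using assms(3) by (simp add: frontier_def)
  ultimately have "(U - K) \<inter> M \<noteq> {}"
    using open_Int_closure_eq_empty[of "U - K" M] by blast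
  then show thesis using that by blast
qed

theorem lemma3p4:
  fixes M :: "complex set"
  assumes "\<exists>K :: nat \<Rightarrow> complex set.
      (\<forall>i\<ge>1. compact (K i) \<and> K i \<subseteq> M) \<and>
      (\<forall>L. compact L \<and> L \<subseteq> M \<and> connected (UNIV - L) \<longrightarrow> (\<exists>i\<^sub>0\<ge>1. L \<subseteq> K i\<^sub>0))"
  shows "openin (top_of_set (frontier M)) (M \<inter> frontier M)"
proof (rule ccontr)
  obtain K :: "nat \<Rightarrow> complex set"
    where K: "\<forall>i\<ge>1. compact (K i) \<and> K i \<subseteq> M"
      and exhaust: "\<forall>L. compact L \<and> L \<subseteq> M \<and> connected (UNIV - L) \<longrightarrow> (\<exists>i\<ge>1. L \<subseteq> K i)"
    using assms by (elim exE conjE)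
  assume "\<not> ?thesis"
  then obtain z where z: "z \<in> M" and
    near: "\<And>e. e > 0 \<Longrightarrow> \<exists>w. w \<in> ball z e \<and> w \<in> frontier M \<and> w \<notin> M"
    by (auto simp: openin_contains_ball subset_iff)
  \<comment> \<open>The index is shifted because \<open>K i\<close> is known to be compact and
    inside \<open>M\<close> only for \<open>i\<close> \<ge> 1.\<close>
  have "\<exists>x. x \<in> M \<and> x \<notin> K (Suc n) \<and> dist x z < inverse (real (Suc n))" for n
  proof -
    \<comment> \<open>The point \<open>z\<close> may itself lie in \<open>K (Suc n)\<close>, so the
      escape from \<open>K (Suc n)\<close> takes place near a frontier point \<open>w\<close>
      outside \<open>M\<close>.\<close>
    obtain w where "w \<in> ball z (inverse (real (Suc n)))" "w \<in> frontier M" "w \<notin> M"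
      using near[of "inverse (real (Suc n))"] by auto
    then obtain x where "x \<in> M" "x \<notin> K (Suc n)" "x \<in> ball z (inverse (real (Suc n)))"
      using frontier_not_mem_escapes_compact[of "K (Suc n)" M w "ball z (inverse (real (Suc n)))"] K
      by auto
    then show ?thesis by (auto simp: dist_commute)
  qed
  then obtain x where x: "\<And>n. x n \<in> M" "\<And>n. x n \<notin> K (Suc n)"
      "\<And>n. dist (x n) z < inverse (real (Suc n))"
    by metis
  have "(\<lambda>n. dist (x n) z) \<longlonglongrightarrow> 0"
    by (rule real_tendsto_sandwich[OF _ _ tendsto_const LIMSEQ_inverse_real_of_nat])
       (use x(3) in \<open>auto intro!: always_eventually less_imp_le\<close>)
  then have "x \<longlonglongrightarrow> z"
    by (rule tendsto_dist_iff[THEN iffD2])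
  then have "compact (insert z (range x))"
    by (rule compact_sequence_with_limit)
  \<comment> \<open>Removing countably many points cannot disconnect a space of real dimension at
    least 2, such as the plane.\<close>
  moreover have "connected (UNIV - insert z (range x))"
    using path_connected_complement_countable[of "insert z (range x)"]
    by (simp add: Compl_eq_Diff_UNIV path_connected_imp_connected)
  ultimately obtain i where "i \<ge> 1" "insert z (range x) \<subseteq> K i"
    using exhaust x(1) z by blast
  \<comment> \<open>As \<open>i\<close> \<ge> 1, \<open>Suc (i - 1)\<close> is \<open>i\<close>, so
    \<open>x (i - 1)\<close> lies outside \<open>K i\<close>.\<close>
  then show False
    using x(2)[of "i - 1"] by auto
qed

end
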